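(* Let $D$ be an integral domain with quotient field $K$, and suppose $D = \bigcap_\alpha D_\alpha$ where each $D_\alpha$ is a flat overring of $D$. For $A \in F(D)$ put $A^\star = \bigcap_\alpha A D_\alpha$. Then the following are equivalent: (1) The map $A \mapsto \bigcap_\alpha AD_\alpha = A^\star$ has finite character. (2) For every $A \in F(D)$, $A^\star = D$ implies that there exists a finitely generated ideal $B \subseteq A$ with $B^\star = D$.
   Context: A fractional ideal of $D$ is a $D$-submodule $A$ of $K$ with $xA \subseteq D$ for some nonzero $x \in D$. $F(D)$ is the set of nonzero fractional ideals of $D$, and $f(D)$ the set of nonzero finitely generated fractional ideals. An overring of $D$ is a ring $D'$ with $D \subseteq D' \subseteq K$; it is a flat overring if it is flat as a $D$-module. The map $A \mapsto A^\star=\bigcap_\alpha AD_\alpha$ is a star-operation on $F(D)$, i.e. a map $F(D)\to F(D)$ such that for all $A,B\in F(D)$ and $0\neq a\in K$: $(a)^\star=(a)$, $(aA)^\star=aA^\star$, $A\subseteq A^\star$, $A\subseteq B$ implies $A^\star\subseteq B^\star$, and $(A^\star)^\star=A^\star$. It has finite character if $A^\star = \bigcup\{B^\star \mid B \in f(D),\ B \subseteq A\}$ for every $A \in F(D)$. *)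

theory Defs
  imports "HOL-Algebra.Algebra"
begin

section \<open>Tensor products and flat modules\<close>

definition linear_maps ::
  "('r, 'e) ring_scheme \<Rightarrow> ('r, 'm, 'x) module_scheme \<Rightarrow> ('r, 'n, 'y) module_scheme \<Rightarrow> ('m \<Rightarrow> 'n) set"
  where "linear_maps R M N =
    {f \<in> hom (add_monoid M) (add_monoid N).
       \<forall>r \<in> carrier R. \<forall>x \<in> carrier M. f (r \<odot>\<^bsub>M\<^esub> x) = r \<odot>\<^bsub>N\<^esub> f x}"

definition tensor_relations ::
  "('r, 'e) ring_scheme \<Rightarrow> ('r, 'm, 'x) module_scheme \<Rightarrow> ('r, 'n, 'y) module_scheme
    \<Rightarrow> ('m \<times> 'n \<Rightarrow>\<^sub>0 int) set"
  where "tensor_relations R M N =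
    generate (free_Abelian_group (carrier M \<times> carrier N))
      ({frag_of (x \<oplus>\<^bsub>M\<^esub> x', y) - frag_of (x, y) - frag_of (x', y) | x x' y.
          x \<in> carrier M \<and> x' \<in> carrier M \<and> y \<in> carrier N} \<union>
       {frag_of (x, y \<oplus>\<^bsub>N\<^esub> y') - frag_of (x, y) - frag_of (x, y') | x y y'.
          x \<in> carrier M \<and> y \<in> carrier N \<and> y' \<in> carrier N} \<union>
       {frag_of (r \<odot>\<^bsub>M\<^esub> x, y) - frag_of (x, r \<odot>\<^bsub>N\<^esub> y) | r x y.
          r \<in> carrier R \<and> x \<in> carrier M \<and> y \<in> carrier N})"

text \<open>Only the additive group of the tensor product is needed.\<close>

definition tensor_product ::
  "('r, 'e) ring_scheme \<Rightarrow> ('r, 'm, 'x) module_scheme \<Rightarrow> ('r, 'n, 'y) module_scheme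
    \<Rightarrow> ('m \<times> 'n \<Rightarrow>\<^sub>0 int) set monoid"
  where "tensor_product R M N =
    free_Abelian_group (carrier M \<times> carrier N) Mod tensor_relations R M N"

text \<open>For a linear map \<open>f\<close> from \<open>N\<close> to \<open>P\<close>, the map from the tensor product of \<open>N\<close> and \<open>M\<close>
  to that of \<open>P\<close> and \<open>M\<close> which sends the class of \<open>(n, m)\<close> to the class of \<open>(f n, m)\<close>. The image
  taken below is a singleton, since \<open>f\<close> carries tensor relations to tensor relations.\<close>

definition tensor_map ::
  "('r, 'e) ring_scheme \<Rightarrow> ('r, 'p, 'y) module_scheme \<Rightarrow> ('r, 'm, 'z) module_scheme
    \<Rightarrow> ('n \<Rightarrow> 'p) \<Rightarrow> ('n \<times> 'm \<Rightarrow>\<^sub>0 int) set \<Rightarrow> ('p \<times> 'm \<Rightarrow>\<^sub>0 int) set"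
  where "tensor_map R P M f C =
    the_elem ((\<lambda>c. r_coset (free_Abelian_group (carrier P \<times> carrier M)) (tensor_relations R P M)
                   (frag_extend (\<lambda>(n, m). frag_of (f n, m)) c)) ` C)"

text \<open>Flatness: tensoring with \<open>M\<close> preserves injectivity of linear maps. HOL cannot quantify over
  all types inside a definition, so the carriers of the test modules \<open>N\<close> and \<open>P\<close> range over the
  subsets of \<^typ>\<open>'r list set\<close>. This loses nothing: every finitely generated \<open>R\<close>-module is a
  quotient of a power of \<open>R\<close>, hence isomorphic to one whose elements are sets of lists over \<open>R\<close>;
  the same goes for every ideal of \<open>R\<close>, via \<open>r \<mapsto> {[r]}\<close>; and injectivity for these test modules
  implies injectivity for all modules.\<close>

definition flat_module :: "('r, 'e) ring_scheme \<Rightarrow> ('r, 'm, 'x) module_scheme \<Rightarrow> bool"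
  where "flat_module R M \<longleftrightarrow> module R M \<and>
    (\<forall>(N :: ('r, 'r list set) module) (P :: ('r, 'r list set) module) f.
       module R N \<longrightarrow> module R P \<longrightarrow> f \<in> linear_maps R N P \<longrightarrow> inj_on f (carrier N) \<longrightarrow>
       inj_on (tensor_map R P M f) (carrier (tensor_product R N M)))"


section \<open>Overrings and fractional ideals\<close>

text \<open>Throughout, \<open>D\<close> is a subset of the carrier of the field \<open>K\<close>; as a ring in its own right it is
  \<^term>\<open>K\<lparr>carrier := D\<rparr>\<close>.\<close>

definition quotient_field :: "('a, 'e) ring_scheme \<Rightarrow> 'a set \<Rightarrow> bool"
  where "quotient_field K D \<longleftrightarrow> field K \<and> subdomain D K \<and>
    (\<forall>x \<in> carrier K. \<exists>a \<in> D. \<exists>b \<in> D - {\<zero>\<^bsub>K\<^esub>}. x = a \<otimes>\<^bsub>K\<^esub> inv\<^bsub>K\<^esub> b)"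

text \<open>A subset \<open>A\<close> of \<open>K\<close> with scalar multiplication given by the multiplication of \<open>K\<close>. (The
  \<open>mult\<close> and \<open>one\<close> fields play no role in the module structure.)\<close>

definition as_module :: "('a, 'e) ring_scheme \<Rightarrow> 'a set \<Rightarrow> ('a, 'a) module"
  where "as_module K A =
    \<lparr>carrier = A, monoid.mult = (\<otimes>\<^bsub>K\<^esub>), monoid.one = \<one>\<^bsub>K\<^esub>, ring.zero = \<zero>\<^bsub>K\<^esub>, ring.add = (\<oplus>\<^bsub>K\<^esub>), smult = (\<otimes>\<^bsub>K\<^esub>)\<rparr>"

definition overring :: "('a, 'e) ring_scheme \<Rightarrow> 'a set \<Rightarrow> 'a set \<Rightarrow> bool"
  where "overring K D E \<longleftrightarrow> subring E K \<and> D \<subseteq> E"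

definition flat_overring :: "('a, 'e) ring_scheme \<Rightarrow> 'a set \<Rightarrow> 'a set \<Rightarrow> bool"
  where "flat_overring K D E \<longleftrightarrow>
    overring K D E \<and> flat_module (K\<lparr>carrier := D\<rparr>) (as_module K E)"

definition is_submodule :: "('a, 'e) ring_scheme \<Rightarrow> 'a set \<Rightarrow> 'a set \<Rightarrow> bool"
  where "is_submodule K D A \<longleftrightarrow>
    submodule A (K\<lparr>carrier := D\<rparr>) (as_module K (carrier K))"

definition fractional_ideals :: "('a, 'e) ring_scheme \<Rightarrow> 'a set \<Rightarrow> 'a set set"
  where "fractional_ideals K D =
    {A. is_submodule K D A \<and> A \<noteq> {\<zero>\<^bsub>K\<^esub>} \<and>
        (\<exists>x \<in> D - {\<zero>\<^bsub>K\<^esub>}. \<forall>a \<in> A. x \<otimes>\<^bsub>K\<^esub> a \<in> D)}"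

definition fg_fractional_ideals :: "('a, 'e) ring_scheme \<Rightarrow> 'a set \<Rightarrow> 'a set set"
  where "fg_fractional_ideals K D =
    {A \<in> fractional_ideals K D.
        \<exists>S. finite S \<and> S \<subseteq> carrier K \<and> A = is_submodule K D hull S}"

text \<open>The operation \<open>A \<mapsto> \<Inter>\<^sub>\<alpha> A D\<^sub>\<alpha>\<close>. The library's \<open>ideal_prod\<close> is, for arbitrary nonempty
  subsets, the set of finite sums of products. Intersecting with \<^term>\<open>carrier K\<close> only matters
  for an empty family, whose intersection inside \<open>K\<close> is \<open>K\<close>.\<close>

definition star_of :: "('a, 'e) ring_scheme \<Rightarrow> 'i set \<Rightarrow> ('i \<Rightarrow> 'a set) \<Rightarrow> 'a set \<Rightarrow> 'a set"
  where "star_of K I E A = carrier K \<inter> (\<Inter>\<alpha>\<in>I. A \<cdot>\<^bsub>K\<^esub> E \<alpha>)"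

definition finite_character :: "('a, 'e) ring_scheme \<Rightarrow> 'a set \<Rightarrow> ('a set \<Rightarrow> 'a set) \<Rightarrow> bool"
  where "finite_character K D star \<longleftrightarrow>
    (\<forall>A \<in> fractional_ideals K D.
       star A = \<Union>{star B | B. B \<in> fg_fractional_ideals K D \<and> B \<subseteq> A})"

end

theory Submission
  imports Defs
begin

text \<open>For (2) to (1), let \<open>0 \<noteq> x \<in> A\<^sup>\<star>\<close> and put \<open>A' = x\<inverse> A\<close>, so that \<open>1\<close> lies in every \<open>A' D\<^sub>\<alpha>\<close>.
  Flatness gives \<open>(A' \<inter> D) D\<^sub>\<alpha> = A' D\<^sub>\<alpha> \<inter> D\<^sub>\<alpha>\<close>, hence \<open>(A' \<inter> D)\<^sup>\<star> = D\<close>. If \<open>B \<subseteq> A' \<inter> D\<close> is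
  finitely generated with \<open>B\<^sup>\<star> = D\<close>, then \<open>x B \<subseteq> A\<close> and \<open>x \<in> (x B)\<^sup>\<star>\<close>. Conversely, by finite
  character \<open>1 \<in> A\<^sup>\<star>\<close> already lies in \<open>B\<^sup>\<star>\<close> for some finitely generated \<open>B \<subseteq> A\<close>.\<close>

section \<open>Flat modules and tensor relations\<close>

lemma tensor_relations_gens:
  shows tensor_relations_add_left:
    "\<lbrakk>x \<in> carrier M; x' \<in> carrier M; y \<in> carrier N\<rbrakk> \<Longrightarrow>
      frag_of (x \<oplus>\<^bsub>M\<^esub> x', y) - frag_of (x, y) - frag_of (x', y) \<in> tensor_relations R M N"
    and tensor_relations_add_right:
    "\<lbrakk>x \<in> carrier M; y \<in> carrier N; y' \<in> carrier N\<rbrakk> \<Longrightarrow>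
      frag_of (x, y \<oplus>\<^bsub>N\<^esub> y') - frag_of (x, y) - frag_of (x, y') \<in> tensor_relations R M N"
    and tensor_relations_smult:
    "\<lbrakk>r \<in> carrier R; x \<in> carrier M; y \<in> carrier N\<rbrakk> \<Longrightarrow>
      frag_of (r \<odot>\<^bsub>M\<^esub> x, y) - frag_of (x, r \<odot>\<^bsub>N\<^esub> y) \<in> tensor_relations R M N"
  unfolding tensor_relations_def
    apply (rule generate.incl, rule UnI1, rule UnI1, blast)
   apply (rule generate.incl, rule UnI1, rule UnI2, blast)
  apply (rule generate.incl, rule UnI2, blast)
  done

text \<open>The second conclusion is the universal property, stated for a map that is bilinear
  only modulo the subgroup \<open>J\<close>.\<close>

lemma
  assumes M: "module R M" and N: "module R N"
  shows tensor_relations_subgroup: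
      "subgroup (tensor_relations R M N) (free_Abelian_group (carrier M \<times> carrier N))"
    and tensor_relations_hom:
      "\<lbrakk>h \<in> hom (free_Abelian_group (carrier M \<times> carrier N)) G; group G; subgroup J G;
        \<And>x x' y. \<lbrakk>x \<in> carrier M; x' \<in> carrier M; y \<in> carrier N\<rbrakk> \<Longrightarrow>
          h (frag_of (x \<oplus>\<^bsub>M\<^esub> x', y) - frag_of (x, y) - frag_of (x', y)) \<in> J;
        \<And>x y y'. \<lbrakk>x \<in> carrier M; y \<in> carrier N; y' \<in> carrier N\<rbrakk> \<Longrightarrow>
          h (frag_of (x, y \<oplus>\<^bsub>N\<^esub> y') - frag_of (x, y) - frag_of (x, y')) \<in> J;
        \<And>r x y. \<lbrakk>r \<in> carrier R; x \<in> carrier M; y \<in> carrier N\<rbrakk> \<Longrightarrow>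
          h (frag_of (r \<odot>\<^bsub>M\<^esub> x, y) - frag_of (x, r \<odot>\<^bsub>N\<^esub> y)) \<in> J;
        c \<in> tensor_relations R M N\<rbrakk> \<Longrightarrow> h c \<in> J"
proof -
  interpret M: module R M by (rule M)
  interpret N: module R N by (rule N)
  let ?F = "free_Abelian_group (carrier M \<times> carrier N)"
  let ?X = "{frag_of (x \<oplus>\<^bsub>M\<^esub> x', y) - frag_of (x, y) - frag_of (x', y) | x x' y.
          x \<in> carrier M \<and> x' \<in> carrier M \<and> y \<in> carrier N} \<union>
       {frag_of (x, y \<oplus>\<^bsub>N\<^esub> y') - frag_of (x, y) - frag_of (x, y') | x y y'.
          x \<in> carrier M \<and> y \<in> carrier N \<and> y' \<in> carrier N} \<union>
       {frag_of (r \<odot>\<^bsub>M\<^esub> x, y) - frag_of (x, r \<odot>\<^bsub>N\<^esub> y) | r x y.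
          r \<in> carrier R \<and> x \<in> carrier M \<and> y \<in> carrier N}"
  have diff: "a - b \<in> carrier ?F" if "a \<in> carrier ?F" "b \<in> carrier ?F" for a b
    using that keys_diff[of a b] by auto
  have X: "?X \<subseteq> carrier ?F"
  proof (intro Un_least subsetI; elim CollectE exE conjE; hypsubst)
  qed (intro diff; simp)+
  show "subgroup (tensor_relations R M N) ?F"
    unfolding tensor_relations_def
    by (rule group.generate_is_subgroup[OF group_free_Abelian_group X])
  show "h c \<in> J" if h: "h \<in> hom ?F G" and G: "group G" and J: "subgroup J G"
    and 1: "\<And>x x' y. \<lbrakk>x \<in> carrier M; x' \<in> carrier M; y \<in> carrier N\<rbrakk> \<Longrightarrow>
          h (frag_of (x \<oplus>\<^bsub>M\<^esub> x', y) - frag_of (x, y) - frag_of (x', y)) \<in> J"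
    and 2: "\<And>x y y'. \<lbrakk>x \<in> carrier M; y \<in> carrier N; y' \<in> carrier N\<rbrakk> \<Longrightarrow>
          h (frag_of (x, y \<oplus>\<^bsub>N\<^esub> y') - frag_of (x, y) - frag_of (x, y')) \<in> J"
    and 3: "\<And>r x y. \<lbrakk>r \<in> carrier R; x \<in> carrier M; y \<in> carrier N\<rbrakk> \<Longrightarrow>
          h (frag_of (r \<odot>\<^bsub>M\<^esub> x, y) - frag_of (x, r \<odot>\<^bsub>N\<^esub> y)) \<in> J"
    and c: "c \<in> tensor_relations R M N"
  proof -
    interpret h: group_hom ?F G h
      using h G by (simp add: group_hom_def group_hom_axioms_def)
    have XJ: "h ` ?X \<subseteq> J"
      by (intro image_subsetI, elim UnE CollectE exE conjE; hypsubst) (rule 1 2 3; assumption)+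
    have "c \<in> generate ?F ?X"
      using c by (simp add: tensor_relations_def)
    then have "h c \<in> h ` generate ?F ?X" by (rule imageI)
    \<comment> \<open>A homomorphism maps the subgroup generated by \<open>?X\<close> onto the
      subgroup generated by the image of \<open>?X\<close>. Checking the generators is therefore
      enough.\<close>
    also have "\<dots> = generate G (h ` ?X)" by (rule h.generate_img[OF X, symmetric])
    also have "\<dots> \<subseteq> J"
      by (rule h.H.generate_subgroup_incl[OF XJ J])
    finally show ?thesis .
  qed
qed

section \<open>Maps induced on tensor products\<close>

text \<open>Membership in a free Abelian group over a set is a condition on the support, so this
  bound is what places the induced map in the free group over \<open>U \<times> T\<close>.\<close>

lemma keys_frag_extend_map:
  assumes "Poly_Mapping.keys c \<subseteq> S \<times> T" "\<And>x. x \<in> S \<Longrightarrow> f x \<in> U"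
  shows "Poly_Mapping.keys (frag_extend (\<lambda>(x, y). frag_of (f x, y)) c) \<subseteq> U \<times> T"
proof -
  have "Poly_Mapping.keys (frag_extend (\<lambda>(x, y). frag_of (f x, y)) c) \<subseteq>
      (\<Union>p \<in> Poly_Mapping.keys c. Poly_Mapping.keys ((\<lambda>(x, y). frag_of (f x, y)) p))"
    by (rule keys_frag_extend)
  also have "\<dots> \<subseteq> U \<times> T" using assms by (intro UN_least) auto
  finally show ?thesis .
qed

text \<open>Linearity of \<open>f\<close> sends each generating relation to a relation of the same
  kind. This is what makes \<open>tensor_map\<close> well defined on classes.\<close>

lemma tensor_relations_mono:
  assumes "module R N" "module R P" "module R M" "f \<in> linear_maps R N P"
    "c \<in> tensor_relations R N M"
  shows "frag_extend (\<lambda>(n, m). frag_of (f n, m)) c \<in> tensor_relations R P M"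
proof (rule tensor_relations_hom[OF assms(1,3) _ _ tensor_relations_subgroup[OF assms(2,3)] _ _ _ assms(5)])
  let ?h = "frag_extend (\<lambda>(n, m). frag_of (f n, m))"
  have f: "f x \<in> carrier P" if "x \<in> carrier N" for x
    using assms(4) that by (auto simp: linear_maps_def hom_def)
  have fadd: "f (x \<oplus>\<^bsub>N\<^esub> y) = f x \<oplus>\<^bsub>P\<^esub> f y" if "x \<in> carrier N" "y \<in> carrier N" for x y
    using assms(4) that by (auto simp: linear_maps_def hom_def)
  have fsmult: "f (r \<odot>\<^bsub>N\<^esub> x) = r \<odot>\<^bsub>P\<^esub> f x" if "r \<in> carrier R" "x \<in> carrier N" for r x
    using assms(4) that by (auto simp: linear_maps_def)
  show "?h \<in> hom (free_Abelian_group (carrier N \<times> carrier M)) (free_Abelian_group (carrier P \<times> carrier M))"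
    using f by (intro homI) (simp_all add: frag_extend_add keys_frag_extend_map)
  show "group (free_Abelian_group (carrier P \<times> carrier M))" by simp
  show "?h (frag_of (x \<oplus>\<^bsub>N\<^esub> x', y) - frag_of (x, y) - frag_of (x', y)) \<in> tensor_relations R P M"
    if "x \<in> carrier N" "x' \<in> carrier N" "y \<in> carrier M" for x x' y
    using tensor_relations_add_left[OF f f] that by (simp add: frag_extend_diff fadd)
  show "?h (frag_of (x, y \<oplus>\<^bsub>M\<^esub> y') - frag_of (x, y) - frag_of (x, y')) \<in> tensor_relations R P M"
    if "x \<in> carrier N" "y \<in> carrier M" "y' \<in> carrier M" for x y y'
    using tensor_relations_add_right[OF f] that by (simp add: frag_extend_diff)
  show "?h (frag_of (r \<odot>\<^bsub>N\<^esub> x, y) - frag_of (x, r \<odot>\<^bsub>M\<^esub> y)) \<in> tensor_relations R P M"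
    if "r \<in> carrier R" "x \<in> carrier N" "y \<in> carrier M" for r x y
    using tensor_relations_smult[OF _ f] that by (simp add: frag_extend_diff fsmult)
qed

text \<open>Two representatives of a coset differ by a relation, which is again sent to a relation.
  The image under \<open>the_elem\<close> in \<open>tensor_map\<close> is thus a singleton, and any
  representative computes it.\<close>

lemma tensor_map_r_coset:
  assumes "module R N" "module R P" "module R M" "f \<in> linear_maps R N P"
    and c: "c \<in> carrier (free_Abelian_group (carrier N \<times> carrier M))"
  shows "tensor_map R P M f (tensor_relations R N M #>\<^bsub>free_Abelian_group (carrier N \<times> carrier M)\<^esub> c) =
    tensor_relations R P M #>\<^bsub>free_Abelian_group (carrier P \<times> carrier M)\<^esub>
      frag_extend (\<lambda>(n, m). frag_of (f n, m)) c"
    (is "tensor_map R P M f (?T #>\<^bsub>?F\<^esub> c) = ?U #>\<^bsub>?G\<^esub> ?h c")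
proof -
  have f: "f x \<in> carrier P" if "x \<in> carrier N" for x
    using assms(4) that by (auto simp: linear_maps_def hom_def)
  note T = tensor_relations_subgroup[OF assms(1,3)]
  note U = tensor_relations_subgroup[OF assms(2,3)]
  have hc: "?h c \<in> carrier ?G"
    using c f by (simp add: keys_frag_extend_map)
  have eq: "?U #>\<^bsub>?G\<^esub> ?h b = ?U #>\<^bsub>?G\<^esub> ?h c" if "b \<in> ?T #>\<^bsub>?F\<^esub> c" for b
  proof -
    from that obtain t where t: "t \<in> ?T" "b = t + c" by (auto simp: r_coset_def)
    then have "?h b = ?h t \<otimes>\<^bsub>?G\<^esub> ?h c" by (simp add: frag_extend_add)
    moreover have "?h t \<in> ?U" using assms t by (intro tensor_relations_mono)
    ultimately have "?h b \<in> ?U #>\<^bsub>?G\<^esub> ?h c" by (auto simp: r_coset_def)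
    from group.repr_independence[OF group_free_Abelian_group this hc U] show ?thesis by simp
  qed
  have "c \<in> ?T #>\<^bsub>?F\<^esub> c"
    using c T by (intro group.rcos_self[OF group_free_Abelian_group])
  with eq have "(\<lambda>b. ?U #>\<^bsub>?G\<^esub> ?h b) ` (?T #>\<^bsub>?F\<^esub> c) = {?U #>\<^bsub>?G\<^esub> ?h c}" by blast
  then show ?thesis by (simp add: tensor_map_def)
qed

text \<open>Flatness in the form used below: a pure tensor that vanishes after an injective map
  already vanishes before it. Injectivity is applied to the classes of \<open>frag_of (n, m)\<close>
  and of \<open>0\<close>, which have the same image.\<close>

lemma flat_module_tensor_relations:
  fixes N P :: "('r, 'r list set) module"
  assumes M: "flat_module R M" and N: "module R N" and P: "module R P"
    and f: "f \<in> linear_maps R N P" "inj_on f (carrier N)"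
    and nm: "n \<in> carrier N" "m \<in> carrier M"
    and fnm: "frag_of (f n, m) \<in> tensor_relations R P M"
  shows "frag_of (n, m) \<in> tensor_relations R N M"
proof -
  have M': "module R M" using M by (simp add: flat_module_def)
  let ?F = "free_Abelian_group (carrier N \<times> carrier M)"
  let ?G = "free_Abelian_group (carrier P \<times> carrier M)"
  let ?T = "tensor_relations R N M"
  let ?U = "tensor_relations R P M"
  note T = tensor_relations_subgroup[OF N M']
  note U = tensor_relations_subgroup[OF P M']
  have c: "frag_of (n, m) \<in> carrier ?F" "0 \<in> carrier ?F" using nm by auto
  have "tensor_map R P M f (?T #>\<^bsub>?F\<^esub> frag_of (n, m)) = ?U #>\<^bsub>?G\<^esub> frag_of (f n, m)"
    using tensor_map_r_coset[OF N P M' f(1) c(1)] by simp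
  also have "\<dots> = ?U"
    using fnm by (intro group.coset_join2[OF group_free_Abelian_group] subgroup.mem_carrier[OF U] U)
  also have "?U = ?U #>\<^bsub>?G\<^esub> 0"
    using subgroup.subset[OF U] by (simp add: r_coset_def)
  also have "\<dots> = tensor_map R P M f (?T #>\<^bsub>?F\<^esub> 0)"
    using tensor_map_r_coset[OF N P M' f(1) c(2)] by simp
  finally have *: "tensor_map R P M f (?T #>\<^bsub>?F\<^esub> frag_of (n, m)) = tensor_map R P M f (?T #>\<^bsub>?F\<^esub> 0)" .
  have carr: "?T #>\<^bsub>?F\<^esub> b \<in> carrier (tensor_product R N M)" if "b \<in> carrier ?F" for b
    using that by (auto simp: tensor_product_def FactGroup_def RCOSETS_def)
  have "inj_on (tensor_map R P M f) (carrier (tensor_product R N M))"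
    using M N P f by (auto simp: flat_module_def)
  from inj_onD[OF this * carr carr] c have "?T #>\<^bsub>?F\<^esub> frag_of (n, m) = ?T #>\<^bsub>?F\<^esub> 0" by blast
  also have "\<dots> = ?T" by (simp add: r_coset_def)
  finally show ?thesis
    using group.rcos_self[OF group_free_Abelian_group c(1) T] by simp
qed

section \<open>Submodules of the quotient field\<close>

locale quotient_field_pair = field K for K :: "('a, 'e) ring_scheme" (structure) +
  fixes D :: "'a set"
  assumes quotient_field: "quotient_field K D"
begin

lemma subring_D: "subring D K"
  using quotient_field by (simp add: quotient_field_def subdomain_def subcring_def)

lemma D_carr: "x \<in> D \<Longrightarrow> x \<in> carrier K"
  using subringE(1)[OF subring_D] by auto

lemma cring_D: "cring (K\<lparr>carrier := D\<rparr>)"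
  using quotient_field by (simp add: quotient_field_def subcring_iff subdomain_def D_carr subsetI)

text \<open>Any denominator of \<open>x\<close> serves as \<open>q\<close>; it clears
  \<open>x\<close> when a fractional ideal is scaled by \<open>x\<close>.\<close>

lemma fraction_denominator:
  assumes "x \<in> carrier K"
  obtains q where "q \<in> D" "q \<noteq> \<zero>" "q \<otimes> x \<in> D"
proof -
  obtain a q where aq: "a \<in> D" "q \<in> D - {\<zero>}" "x = a \<otimes> inv q"
    using assms quotient_field unfolding quotient_field_def by blast
  then have "q \<otimes> x = a"
    by (simp add: D_carr field_Units m_lcomm)
  with aq that show thesis by auto
qed

lemma inv_nonzero:
  assumes "x \<in> carrier K" "x \<noteq> \<zero>"
  shows "inv x \<in> carrier K" "inv x \<noteq> \<zero>" "inv (inv x) = x"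
proof -
  have "x \<in> Units K" using assms by (simp add: field_Units)
  then have "inv x \<in> Units K" "inv (inv x) = x" by auto
  then show "inv x \<in> carrier K" "inv x \<noteq> \<zero>" "inv (inv x) = x" by (auto simp: field_Units)
qed

lemma module_as_module:
  assumes "subring E K" "D \<subseteq> E"
  shows "module (K\<lparr>carrier := D\<rparr>) (as_module K E)"
proof -
  have c: "x \<in> carrier K" if "x \<in> E" for x
    using that subringE(1)[OF assms(1)] by auto
  note [simp] = subringE(2-)[OF assms(1)]
  have "\<exists>y\<in>E. y \<oplus> x = \<zero>" if "x \<in> E" for x
    using that by (intro bexI[of _ "\<ominus> x"]) (auto simp: c l_neg)
  then have "abelian_group (as_module K E)"
    by (intro abelian_groupI) (auto simp: as_module_def c a_ac)
  then show ?thesis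
    using assms(2) by (intro moduleI cring_D) (auto simp: as_module_def c D_carr l_distr r_distr m_assoc)
qed

text \<open>Closure under negation is scaling by \<open>\<ominus> \<one>\<close>, an element of
  \<open>D\<close>, so closure under addition and under scaling by \<open>D\<close> together with
  \<open>\<zero>\<close> characterises submodules.\<close>

lemma is_submodule_iff:
  "is_submodule K D A \<longleftrightarrow> A \<subseteq> carrier K \<and> \<zero> \<in> A \<and>
    (\<forall>x\<in>A. \<forall>y\<in>A. x \<oplus> y \<in> A) \<and> (\<forall>r\<in>D. \<forall>x\<in>A. r \<otimes> x \<in> A)"
proof
  interpret V: module "K\<lparr>carrier := D\<rparr>" "as_module K (carrier K)"
    by (intro module_as_module carrier_is_subring) (auto simp: D_carr)
  show "A \<subseteq> carrier K \<and> \<zero> \<in> A \<and>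
    (\<forall>x\<in>A. \<forall>y\<in>A. x \<oplus> y \<in> A) \<and> (\<forall>r\<in>D. \<forall>x\<in>A. r \<otimes> x \<in> A)" if "is_submodule K D A"
  proof -
    have "submodule A (K\<lparr>carrier := D\<rparr>) (as_module K (carrier K))"
      using that by (simp add: is_submodule_def)
    from V.submoduleE[OF this] subgroup.one_closed[OF submodule.axioms(1)[OF this]]
    show ?thesis by (auto simp: as_module_def)
  qed
  assume A: "A \<subseteq> carrier K \<and> \<zero> \<in> A \<and>
    (\<forall>x\<in>A. \<forall>y\<in>A. x \<oplus> y \<in> A) \<and> (\<forall>r\<in>D. \<forall>x\<in>A. r \<otimes> x \<in> A)"
  have neg: "\<ominus>\<^bsub>as_module K (carrier K)\<^esub> a \<in> A" if "a \<in> A" for a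
  proof -
    have a: "a \<in> carrier K" using that A by auto
    have "\<ominus> \<one> \<in> D" using subringE(3,5)[OF subring_D] by auto
    then have "\<ominus> \<one> \<otimes> a \<in> A" using that A by auto
    moreover have "\<ominus> \<one> \<otimes> a = \<ominus> a" using a by algebra
    moreover have "\<ominus>\<^bsub>as_module K (carrier K)\<^esub> a = \<ominus> a"
      by (rule V.minus_equality) (auto simp: as_module_def l_neg a)
    ultimately show ?thesis by simp
  qed
  show "is_submodule K D A"
    unfolding is_submodule_def
    by (rule V.submoduleI) (use A neg in \<open>auto simp: as_module_def\<close>)
qed

lemma
  assumes "is_submodule K D A"
  shows submodule_carr: "a \<in> A \<Longrightarrow> a \<in> carrier K"
    and submodule_zero: "\<zero> \<in> A"
    and submodule_add: "a \<in> A \<Longrightarrow> b \<in> A \<Longrightarrow> a \<oplus> b \<in> A"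
    and submodule_smult: "r \<in> D \<Longrightarrow> a \<in> A \<Longrightarrow> r \<otimes> a \<in> A"
  using assms by (auto simp: is_submodule_iff)

lemma submodule_uminus:
  assumes "is_submodule K D A" "a \<in> A"
  shows "\<ominus> a \<in> A"
proof -
  have "\<ominus> \<one> \<otimes> a \<in> A"
    using assms subringE(3,5)[OF subring_D] by (intro submodule_smult) auto
  then show ?thesis using submodule_carr[OF assms] by (simp add: l_minus)
qed

lemma submodule_minus:
  "is_submodule K D A \<Longrightarrow> a \<in> A \<Longrightarrow> b \<in> A \<Longrightarrow> a \<ominus> b \<in> A"
  by (simp add: a_minus_def submodule_add submodule_uminus)

lemma submodule_D: "is_submodule K D D"
  using subringE[OF subring_D] by (auto simp: is_submodule_iff)

lemma submodule_inter:
  "is_submodule K D A \<Longrightarrow> is_submodule K D B \<Longrightarrow> is_submodule K D (A \<inter> B)"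
  by (auto simp: is_submodule_iff)

lemma submodule_imp_ideal:
  assumes sub: "is_submodule K D B" and BD: "B \<subseteq> D"
  shows "ideal B (K\<lparr>carrier := D\<rparr>)"
proof -
  interpret R: cring "K\<lparr>carrier := D\<rparr>" by (rule cring_D)
  note [simp] = submodule_carr[OF sub]
  \<comment> \<open>Negation in the restricted ring is a priori another function than negation in
    \<open>K\<close>; uniqueness of additive inverses identifies the two.\<close>
  have neg: "\<ominus>\<^bsub>K\<lparr>carrier := D\<rparr>\<^esub> b \<in> B" if b: "b \<in> B" for b
  proof -
    have "\<ominus>\<^bsub>K\<lparr>carrier := D\<rparr>\<^esub> b = \<ominus> b"
      by (rule R.minus_equality) (use b BD submodule_uminus[OF sub] in \<open>auto simp: l_neg\<close>)
    then show ?thesis using submodule_uminus[OF sub b] by simp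
  qed
  have "subgroup B (add_monoid (K\<lparr>carrier := D\<rparr>))"
    by (rule R.add.subgroupI)
      (use BD submodule_zero[OF sub] submodule_add[OF sub] neg in auto)
  moreover have "b \<otimes> x \<in> B" if "b \<in> B" "x \<in> D" for b x
    using submodule_smult[OF sub that(2,1)] that by (simp add: m_comm D_carr)
  ultimately show ?thesis
    using submodule_smult[OF sub] by (intro idealI R.ring_axioms) auto
qed

lemma submodule_hull:
  assumes "S \<subseteq> carrier K"
  shows "is_submodule K D (is_submodule K D hull S)"
proof -
  \<comment> \<open>The field is itself a submodule containing \<open>S\<close>, so the hull is an
    intersection over a nonempty family and stays inside \<open>K\<close>.\<close>
  have K: "is_submodule K D (carrier K)"
    by (auto simp: is_submodule_iff D_carr)
  then have "is_submodule K D hull S \<subseteq> carrier K" using assms by (rule hull_minimal[rotated])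
  then show ?thesis
    by (subst is_submodule_iff) (auto simp: hull_def is_submodule_iff)
qed

section \<open>Products of submodules with overrings\<close>

text \<open>A scalar from \<open>E\<close> can be absorbed into the second factor of each product,
  so the result is even an \<open>E\<close>-module; scaling by \<open>D\<close> is the special case
  \<open>D \<subseteq> E\<close>.\<close>

lemma ideal_prod_submodule:
  assumes A: "is_submodule K D A" and E: "overring K D E"
  shows "is_submodule K D (A \<cdot> E)" "z \<in> A \<cdot> E \<Longrightarrow> e \<in> E \<Longrightarrow> e \<otimes> z \<in> A \<cdot> E"
proof -
  have c: "x \<in> carrier K" if "x \<in> E" for x
    using that subringE(1) E by (auto simp: overring_def)
  have carr: "z \<in> carrier K" if "z \<in> A \<cdot> E" for z
    using that by induction (auto simp: submodule_carr[OF A] c)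
  have m: "e \<otimes> z \<in> A \<cdot> E" if "z \<in> A \<cdot> E" "e \<in> E" for z e
    using that
  proof induction
    case (prod a f)
    then have "a \<otimes> (e \<otimes> f) \<in> A \<cdot> E"
      using E by (intro ideal_prod.prod) (auto simp: overring_def dest: subringE(6))
    then show ?case using prod by (simp add: m_lcomm submodule_carr[OF A] c)
  next
    case (sum x y)
    then show ?case by (simp add: r_distr carr c ideal_prod.sum)
  qed
  then show "z \<in> A \<cdot> E \<Longrightarrow> e \<in> E \<Longrightarrow> e \<otimes> z \<in> A \<cdot> E" .
  have "\<one> \<in> E" using E subringE(3) by (auto simp: overring_def)
  then have "\<zero> \<otimes> \<one> \<in> A \<cdot> E"
    using submodule_zero[OF A] by (intro ideal_prod.prod)
  then show "is_submodule K D (A \<cdot> E)"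
    using m E carr by (auto simp: is_submodule_iff overring_def intro: ideal_prod.sum)
qed

lemma subset_ideal_prod:
  assumes "is_submodule K D A" "overring K D E"
  shows "A \<subseteq> A \<cdot> E"
proof
  fix a assume a: "a \<in> A"
  have "\<one> \<in> E" using assms subringE(3) by (auto simp: overring_def)
  with a have "a \<otimes> \<one> \<in> A \<cdot> E" by (rule ideal_prod.prod)
  then show "a \<in> A \<cdot> E" using a assms submodule_carr by auto
qed

lemma ideal_prod_mono:
  assumes "A \<subseteq> B"
  shows "A \<cdot> E \<subseteq> B \<cdot> E"
proof
  fix z assume "z \<in> A \<cdot> E" then show "z \<in> B \<cdot> E"
    by induction (use assms in \<open>auto intro: ideal_prod.intros\<close>)
qed

section \<open>Scaling by elements of the field\<close>

lemma ideal_prod_scale: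
  assumes "is_submodule K D A" "overring K D E" "x \<in> carrier K" "z \<in> A \<cdot> E"
  shows "x \<otimes> z \<in> ((\<otimes>) x ` A) \<cdot> E"
  using assms(4)
proof induction
  case (prod a e)
  have c: "e \<in> carrier K" using prod(2) assms(2) subringE(1) by (auto simp: overring_def)
  have "(x \<otimes> a) \<otimes> e \<in> ((\<otimes>) x ` A) \<cdot> E"
    using prod by (intro ideal_prod.prod) auto
  then show ?case using submodule_carr[OF assms(1) prod(1)] assms(3) c by (simp add: m_assoc)
next
  case (sum y z)
  then show ?case
    using ideal_prod_submodule(1)[OF assms(1,2)] assms(3)
    by (simp add: r_distr submodule_carr ideal_prod.sum)
qed

lemma submodule_scale:
  assumes A: "is_submodule K D A" and x: "x \<in> carrier K"
  shows "is_submodule K D ((\<otimes>) x ` A)"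
  unfolding is_submodule_iff
proof (intro conjI ballI)
  note [simp] = submodule_carr[OF A] D_carr
  show "(\<otimes>) x ` A \<subseteq> carrier K" using x by auto
  show "\<zero> \<in> (\<otimes>) x ` A" using x submodule_zero[OF A] by (auto intro!: image_eqI[of _ _ \<zero>])
  show "y \<oplus> z \<in> (\<otimes>) x ` A" if yz: "y \<in> (\<otimes>) x ` A" "z \<in> (\<otimes>) x ` A" for y z
  proof -
    from yz obtain a b where ab: "a \<in> A" "b \<in> A" "y = x \<otimes> a" "z = x \<otimes> b" by auto
    with x have "y \<oplus> z = x \<otimes> (a \<oplus> b)" by (simp add: r_distr)
    with ab submodule_add[OF A] show ?thesis by auto
  qed
  show "r \<otimes> y \<in> (\<otimes>) x ` A" if ry: "r \<in> D" "y \<in> (\<otimes>) x ` A" for r y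
  proof -
    from ry obtain a where a: "a \<in> A" "y = x \<otimes> a" by auto
    with x ry have "r \<otimes> y = x \<otimes> (r \<otimes> a)" by (simp add: m_lcomm)
    with a ry submodule_smult[OF A] show ?thesis by auto
  qed
qed

lemma scale_scale_inv:
  assumes "A \<subseteq> carrier K" "x \<in> carrier K" "x \<noteq> \<zero>"
  shows "(\<otimes>) x ` (\<otimes>) (inv x) ` A = A"
proof -
  have "x \<otimes> (inv x \<otimes> a) = a" if "a \<in> A" for a
    using that assms by (subst m_assoc[symmetric]) (auto simp: field_Units)
  then show ?thesis by (force simp: image_image)
qed

text \<open>Scaling by \<open>x\<close> and by \<open>inv x\<close> are mutually inverse and both
  preserve submodules, so each inclusion follows from the minimality of a hull.\<close>

lemma hull_scale:
  assumes "S \<subseteq> carrier K" "x \<in> carrier K" "x \<noteq> \<zero>"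
  shows "(\<otimes>) x ` (is_submodule K D hull S) = is_submodule K D hull ((\<otimes>) x ` S)"
proof
  have xS: "(\<otimes>) x ` S \<subseteq> carrier K" using assms by auto
  note ix = inv_nonzero[OF assms(2,3)]
  let ?H = "is_submodule K D hull ((\<otimes>) x ` S)"
  have "S = (\<otimes>) (inv x) ` (\<otimes>) x ` S"
    using scale_scale_inv[of S "inv x"] assms ix by simp
  also have "\<dots> \<subseteq> (\<otimes>) (inv x) ` ?H" by (intro image_mono hull_subset)
  finally have "is_submodule K D hull S \<subseteq> (\<otimes>) (inv x) ` ?H"
    by (intro hull_minimal submodule_scale submodule_hull xS ix)
  then have "(\<otimes>) x ` (is_submodule K D hull S) \<subseteq> (\<otimes>) x ` (\<otimes>) (inv x) ` ?H" by (rule image_mono)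
  also have "\<dots> = ?H"
    using submodule_carr[OF submodule_hull[OF xS]] assms by (intro scale_scale_inv) auto
  finally show "(\<otimes>) x ` (is_submodule K D hull S) \<subseteq> ?H" .
  show "?H \<subseteq> (\<otimes>) x ` (is_submodule K D hull S)"
    by (intro hull_minimal submodule_scale submodule_hull assms image_mono hull_subset)
qed

text \<open>If \<open>q\<close> clears \<open>x\<close> and \<open>d\<close> clears
  \<open>A\<close>, then \<open>q \<otimes> d\<close> clears the scaled ideal, because the product
  regroups as \<open>(q \<otimes> x) \<otimes> (d \<otimes> b)\<close>.\<close>

lemma fractional_ideals_scale:
  assumes A: "A \<in> fractional_ideals K D" and x: "x \<in> carrier K" "x \<noteq> \<zero>"
  shows "(\<otimes>) x ` A \<in> fractional_ideals K D"
proof -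
  from A obtain d where sub: "is_submodule K D A" and d: "d \<in> D" "d \<noteq> \<zero>" "\<And>a. a \<in> A \<Longrightarrow> d \<otimes> a \<in> D"
    and "A \<noteq> {\<zero>}"
    by (auto simp: fractional_ideals_def)
  with submodule_zero obtain a where a: "a \<in> A" "a \<noteq> \<zero>" by blast
  obtain q where q: "q \<in> D" "q \<noteq> \<zero>" "q \<otimes> x \<in> D" using x fraction_denominator by blast
  note [simp] = submodule_carr[OF sub] D_carr
  have "x \<otimes> a \<noteq> \<zero>" using a x by (simp add: integral_iff)
  with a have "(\<otimes>) x ` A \<noteq> {\<zero>}" by blast
  moreover have "q \<otimes> d \<in> D - {\<zero>}"
    using q d subringE(6)[OF subring_D] by (auto simp: integral_iff)
  moreover have "(q \<otimes> d) \<otimes> (x \<otimes> b) \<in> D" if "b \<in> A" for b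
  proof -
    have "(q \<otimes> d) \<otimes> (x \<otimes> b) = (q \<otimes> x) \<otimes> (d \<otimes> b)"
      using that q d x by (simp add: m_ac)
    then show ?thesis using q d that subringE(6)[OF subring_D] by simp
  qed
  ultimately show ?thesis
    using submodule_scale[OF sub x(1)] unfolding fractional_ideals_def by blast
qed

lemma fg_fractional_ideals_scale:
  assumes B: "B \<in> fg_fractional_ideals K D" and x: "x \<in> carrier K" "x \<noteq> \<zero>"
  shows "(\<otimes>) x ` B \<in> fg_fractional_ideals K D"
proof -
  from B obtain S where S: "finite S" "S \<subseteq> carrier K" "B = is_submodule K D hull S"
    by (auto simp: fg_fractional_ideals_def)
  then have "(\<otimes>) x ` B = is_submodule K D hull ((\<otimes>) x ` S)" "(\<otimes>) x ` S \<subseteq> carrier K"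
    using x by (auto simp: hull_scale)
  moreover have "(\<otimes>) x ` B \<in> fractional_ideals K D"
    using B x by (simp add: fractional_ideals_scale fg_fractional_ideals_def)
  ultimately show ?thesis using S(1) unfolding fg_fractional_ideals_def by blast
qed

section \<open>Flat overrings\<close>

text \<open>A copy of \<open>(S + A) / A\<close> whose elements have the type of the test modules in the
  definition of flatness.\<close>

definition list_coset :: "'a set \<Rightarrow> 'a \<Rightarrow> 'a list set"
  where "list_coset A x = (\<lambda>a. [a \<oplus> x]) ` A"

text \<open>The set \<open>S\<close> restricts where the representative is sought: in
  \<open>carrier K\<close> for the module operations, in \<open>D\<close> for the map from the
  tensor product of \<open>(D + A) / A\<close> and \<open>E\<close> further down.\<close>

definition coset_rep :: "'a set \<Rightarrow> 'a set \<Rightarrow> 'a list set \<Rightarrow> 'a"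
  where "coset_rep A S C = (SOME x. x \<in> S \<and> list_coset A x = C)"

text \<open>Representatives are drawn from all of \<open>K\<close> whatever \<open>S\<close> is. The
  operations are then the same functions for \<open>S = D\<close> and \<open>S = carrier K\<close>,
  and the inclusion between these modules is simply \<open>id\<close>.\<close>

definition quotient_module :: "'a set \<Rightarrow> 'a set \<Rightarrow> ('a, 'a list set) module"
  where "quotient_module A S =
    \<lparr>carrier = list_coset A ` S, monoid.mult = undefined, monoid.one = undefined, ring.zero = list_coset A \<zero>,
     ring.add = (\<lambda>B C. list_coset A (coset_rep A (carrier K) B \<oplus> coset_rep A (carrier K) C)),
     smult = (\<lambda>r C. list_coset A (r \<otimes> coset_rep A (carrier K) C))\<rparr>"

lemma coset_rep:
  assumes "x \<in> S"
  shows "coset_rep A S (list_coset A x) \<in> S" "list_coset A (coset_rep A S (list_coset A x)) = list_coset A x"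
  using someI[of "\<lambda>y. y \<in> S \<and> list_coset A y = list_coset A x" x] assms by (auto simp: coset_rep_def)

lemma list_coset_eq_iff:
  assumes A: "is_submodule K D A" and xy: "x \<in> carrier K" "y \<in> carrier K"
  shows "list_coset A x = list_coset A y \<longleftrightarrow> x \<ominus> y \<in> A"
proof
  note [simp] = submodule_carr[OF A]
  assume "list_coset A x = list_coset A y"
  moreover have "[\<zero> \<oplus> x] \<in> list_coset A x"
    using submodule_zero[OF A] by (auto simp: list_coset_def)
  ultimately obtain a where "a \<in> A" "x = a \<oplus> y" using xy by (auto simp: list_coset_def)
  moreover from this xy have "x \<ominus> y = a" by (simp add: a_minus_def a_assoc r_neg)
  ultimately show "x \<ominus> y \<in> A" by simp
next
  note [simp] = submodule_carr[OF A]
  have sub: "list_coset A u \<subseteq> list_coset A v" if "u \<ominus> v \<in> A" "u \<in> carrier K" "v \<in> carrier K" for u v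
  proof
    fix l assume "l \<in> list_coset A u"
    then obtain a where a: "a \<in> A" "l = [a \<oplus> u]" by (auto simp: list_coset_def)
    moreover have "(a \<oplus> (u \<ominus> v)) \<oplus> v = a \<oplus> u"
      using a that by (simp add: a_minus_def a_assoc l_neg)
    ultimately show "l \<in> list_coset A v"
      using submodule_add[OF A a(1) that(1)] by (force simp: list_coset_def)
  qed
  assume d: "x \<ominus> y \<in> A"
  have "y \<ominus> x = \<ominus> (x \<ominus> y)" using xy by (simp add: a_minus_def minus_add a_comm)
  then have "y \<ominus> x \<in> A" using submodule_uminus[OF A d] by simp
  with d sub xy show "list_coset A x = list_coset A y" by blast
qed

text \<open>Independence of the chosen representatives: each differs from the given element by a
  member of \<open>A\<close>, and the two errors add up within \<open>A\<close>.\<close>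

lemma list_coset_add:
  assumes A: "is_submodule K D A" and xy: "x \<in> carrier K" "y \<in> carrier K"
  shows "list_coset A (coset_rep A (carrier K) (list_coset A x) \<oplus> coset_rep A (carrier K) (list_coset A y)) = list_coset A (x \<oplus> y)"
proof -
  let ?x = "coset_rep A (carrier K) (list_coset A x)" and ?y = "coset_rep A (carrier K) (list_coset A y)"
  have c: "?x \<in> carrier K" "?y \<in> carrier K" using coset_rep xy by auto
  have "?x \<ominus> x \<in> A" "?y \<ominus> y \<in> A"
    using list_coset_eq_iff[OF A] c xy coset_rep(2) by blast+
  then have "(?x \<ominus> x) \<oplus> (?y \<ominus> y) \<in> A" by (rule submodule_add[OF A])
  moreover have "(?x \<ominus> x) \<oplus> (?y \<ominus> y) = (?x \<oplus> ?y) \<ominus> (x \<oplus> y)"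
    using c xy by (simp add: a_minus_def minus_add a_ac)
  ultimately show ?thesis using c xy by (subst list_coset_eq_iff[OF A]) auto
qed

lemma list_coset_smult:
  assumes A: "is_submodule K D A" and x: "x \<in> carrier K" and r: "r \<in> D"
  shows "list_coset A (r \<otimes> coset_rep A (carrier K) (list_coset A x)) = list_coset A (r \<otimes> x)"
proof -
  let ?x = "coset_rep A (carrier K) (list_coset A x)"
  have c: "?x \<in> carrier K" using coset_rep x by auto
  have "?x \<ominus> x \<in> A"
    using list_coset_eq_iff[OF A] c x coset_rep(2) by blast
  then have "r \<otimes> (?x \<ominus> x) \<in> A" by (rule submodule_smult[OF A r])
  moreover have "r \<otimes> (?x \<ominus> x) = (r \<otimes> ?x) \<ominus> (r \<otimes> x)"
    using c x D_carr[OF r] by (simp add: a_minus_def r_distr r_minus)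
  ultimately show ?thesis using c x D_carr[OF r] by (subst list_coset_eq_iff[OF A]) auto
qed

lemma quotient_module_simps:
  shows carrier_quotient_module: "carrier (quotient_module A S) = list_coset A ` S"
    and zero_quotient_module: "\<zero>\<^bsub>quotient_module A S\<^esub> = list_coset A \<zero>"
    and add_quotient_module: "\<lbrakk>is_submodule K D A; x \<in> carrier K; y \<in> carrier K\<rbrakk> \<Longrightarrow>
      list_coset A x \<oplus>\<^bsub>quotient_module A S\<^esub> list_coset A y = list_coset A (x \<oplus> y)"
    and smult_quotient_module: "\<lbrakk>is_submodule K D A; r \<in> D; x \<in> carrier K\<rbrakk> \<Longrightarrow>
      r \<odot>\<^bsub>quotient_module A S\<^esub> list_coset A x = list_coset A (r \<otimes> x)"
  by (simp_all add: quotient_module_def list_coset_add list_coset_smult)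

lemma module_quotient_module:
  assumes A: "is_submodule K D A" and S: "is_submodule K D S"
  shows "module (K\<lparr>carrier := D\<rparr>) (quotient_module A S)"
proof -
  note [simp] = add_quotient_module[OF A] smult_quotient_module[OF A]
    carrier_quotient_module zero_quotient_module subringE(3,6,7)[OF subring_D]
    submodule_carr[OF S] D_carr submodule_zero[OF S] submodule_add[OF S] submodule_smult[OF S]
  have "\<exists>Y\<in>list_coset A ` S. Y \<oplus>\<^bsub>quotient_module A S\<^esub> C = list_coset A \<zero>" if C: "C \<in> list_coset A ` S" for C
  proof -
    obtain x where x: "x \<in> S" "C = list_coset A x" using C by blast
    then show ?thesis
      by (intro bexI[of _ "list_coset A (\<ominus> x)"]) (auto simp: l_neg submodule_uminus[OF S])
  qed
  then have "abelian_group (quotient_module A S)"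
    by (intro abelian_groupI) (auto simp: a_ac)
  then show ?thesis
    by (intro moduleI cring_D) (auto simp: l_distr r_distr m_assoc)
qed

section \<open>Pure tensors with an overring\<close>

text \<open>For \<open>z = a \<otimes> e\<close> the scalar \<open>d \<otimes> a\<close>, which lies
  in \<open>D\<close>, moves to the left factor and turns the class of \<open>inv d\<close> into the
  class of \<open>a\<close>, which is zero in \<open>K / A\<close>. Since \<open>z\<close> may lie
  outside \<open>E\<close>, the tensor of \<open>\<one>\<close> and \<open>z\<close> is replaced by
  that of \<open>inv d\<close> and \<open>d \<otimes> z\<close>.\<close>

lemma tensor_relations_submodule_mult:
  assumes A: "is_submodule K D A" and E: "overring K D E"
    and d: "d \<in> D" "d \<noteq> \<zero>" "\<forall>a\<in>A. d \<otimes> a \<in> D"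
    and "z \<in> A \<cdot> E"
  shows "d \<otimes> z \<in> E \<and> frag_of (list_coset A (inv d), d \<otimes> z) \<in>
    tensor_relations (K\<lparr>carrier := D\<rparr>) (quotient_module A (carrier K)) (as_module K E)"
    (is "_ \<and> _ \<in> ?T")
  using assms(6)
proof induction
  let ?R = "K\<lparr>carrier := D\<rparr>" and ?P = "quotient_module A (carrier K)" and ?M = "as_module K E"
  have K: "is_submodule K D (carrier K)" by (auto simp: is_submodule_iff D_carr)
  have E': "subring E K" "D \<subseteq> E" using E by (auto simp: overring_def)
  have c: "x \<in> carrier K" if "x \<in> E" for x using that subringE(1)[OF E'(1)] by auto
  interpret M: module ?R ?M using module_as_module[OF E'] .
  interpret P: module ?R ?P using module_quotient_module[OF A K] .
  interpret T: subgroup ?T "free_Abelian_group (carrier ?P \<times> carrier ?M)"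
    by (rule tensor_relations_subgroup) unfold_locales
  have T_add: "s + t \<in> ?T" if "s \<in> ?T" "t \<in> ?T" for s t
    using T.m_closed[OF that] by simp
  have T_diff: "s - t \<in> ?T" if "s \<in> ?T" "t \<in> ?T" for s t
    using T_add[OF that(1) T.m_inv_closed[OF that(2)]] T.mem_carrier[OF that(2)] by simp
  have i: "inv d \<in> carrier K" "d \<otimes> inv d = \<one>"
    using d D_carr by (auto simp: field_Units)
  {
    case (prod a e)
    have a: "a \<in> carrier K" and e: "e \<in> carrier K" using prod submodule_carr[OF A] c by auto
    have da: "d \<otimes> a \<in> D" using prod d by auto
    have P0: "list_coset A a = \<zero>\<^bsub>?P\<^esub>"
      using a submodule_zero[OF A] prod by (simp add: zero_quotient_module list_coset_eq_iff[OF A] a_minus_def)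
    have *: "d \<otimes> (a \<otimes> e) = (d \<otimes> a) \<otimes> e" using a e d D_carr by (simp add: m_assoc)
    have "d \<otimes> (a \<otimes> e) \<in> E" unfolding * using da E'(2) prod(2) by (blast intro: subringE(6)[OF E'(1), of "d \<otimes> a" e])
    moreover have "frag_of (list_coset A (inv d), d \<otimes> (a \<otimes> e)) \<in> ?T"
    proof -
      have "frag_of ((d \<otimes> a) \<odot>\<^bsub>?P\<^esub> list_coset A (inv d), e) - frag_of (list_coset A (inv d), (d \<otimes> a) \<odot>\<^bsub>?M\<^esub> e) \<in> ?T"
        using da prod i by (intro tensor_relations_smult) (auto simp: carrier_quotient_module as_module_def)
      moreover have "(d \<otimes> a) \<odot>\<^bsub>?P\<^esub> list_coset A (inv d) = \<zero>\<^bsub>?P\<^esub>"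
      proof -
        have "(d \<otimes> a) \<otimes> inv d = a" using a i d D_carr by (metis m_assoc m_comm m_closed r_one)
        then show ?thesis using A da i P0 by (simp add: smult_quotient_module)
      qed
      moreover have "(d \<otimes> a) \<odot>\<^bsub>?M\<^esub> e = d \<otimes> (a \<otimes> e)" by (simp add: as_module_def *)
      \<comment> \<open>Additivity applied to zero plus zero leaves exactly the negative of this
        generator.\<close>
      moreover have "frag_of (\<zero>\<^bsub>?P\<^esub>, e) \<in> ?T"
      proof -
        have "frag_of (\<zero>\<^bsub>?P\<^esub> \<oplus>\<^bsub>?P\<^esub> \<zero>\<^bsub>?P\<^esub>, e) - frag_of (\<zero>\<^bsub>?P\<^esub>, e) - frag_of (\<zero>\<^bsub>?P\<^esub>, e) \<in> ?T"
          using prod by (intro tensor_relations_add_left) (auto simp: as_module_def)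
        then have "- frag_of (\<zero>\<^bsub>?P\<^esub>, e) \<in> ?T" by simp
        from T_diff[OF T.one_closed this] show ?thesis by simp
      qed
      ultimately show ?thesis using T_diff by fastforce
    qed
    ultimately show ?case ..
  next
    case (sum y z)
    have yz: "y \<in> carrier K" "z \<in> carrier K"
      using sum ideal_prod_submodule(1)[OF A E] submodule_carr by auto
    have *: "d \<otimes> (y \<oplus> z) = d \<otimes> y \<oplus> d \<otimes> z" using yz d D_carr by (simp add: r_distr)
    have "d \<otimes> (y \<oplus> z) \<in> E" unfolding * using sum subringE(7)[OF E'(1)] by auto
    moreover have "frag_of (list_coset A (inv d), d \<otimes> y \<oplus>\<^bsub>?M\<^esub> d \<otimes> z)
        - frag_of (list_coset A (inv d), d \<otimes> y) - frag_of (list_coset A (inv d), d \<otimes> z) \<in> ?T"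
      using sum i by (intro tensor_relations_add_right) (auto simp: carrier_quotient_module as_module_def)
    from T_add[OF T_add[OF this]] sum
    have "frag_of (list_coset A (inv d), d \<otimes> y \<oplus>\<^bsub>?M\<^esub> d \<otimes> z) \<in> ?T" by fastforce
    ultimately show ?case by (simp add: * as_module_def)
  }
qed

text \<open>The map sending a coset and \<open>e\<close> to a representative times \<open>e\<close>
  induces a homomorphism from the tensor product of \<open>(D + A) / A\<close> and \<open>E\<close>
  to \<open>K / (A \<inter> D) E\<close>. It sends the tensor of \<open>\<one>\<close> and
  \<open>z\<close> to the class of \<open>z\<close>, so a vanishing tensor puts \<open>z\<close> in
  the product.\<close>

lemma tensor_relations_quotient_module:
  assumes A: "is_submodule K D A" and E: "overring K D E"
    and z: "z \<in> E"
    and rel: "frag_of (list_coset A \<one>, z) \<in>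
      tensor_relations (K\<lparr>carrier := D\<rparr>) (quotient_module A D) (as_module K E)"
  shows "z \<in> (A \<inter> D) \<cdot> E"
proof -
  let ?R = "K\<lparr>carrier := D\<rparr>" and ?N = "quotient_module A D" and ?M = "as_module K E"
  let ?J = "(A \<inter> D) \<cdot> E"
  have E': "subring E K" "D \<subseteq> E" using E by (auto simp: overring_def)
  have c: "x \<in> carrier K" if "x \<in> E" for x using that subringE(1)[OF E'(1)] by auto
  have M: "module ?R ?M" using module_as_module[OF E'] .
  have N: "module ?R ?N" using module_quotient_module[OF A submodule_D] .
  have AD: "is_submodule K D (A \<inter> D)" by (rule submodule_inter[OF A submodule_D])
  note J = ideal_prod_submodule(1)[OF AD E]
  \<comment> \<open>Representatives are taken in \<open>D\<close>, so that two of the same coset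
    differ by an element of \<open>A \<inter> D\<close> and not merely of \<open>A\<close>. The
    choice makes \<open>?f\<close> bilinear only modulo \<open>?J\<close>.\<close>
  let ?f = "\<lambda>(C, e). coset_rep A D C \<otimes> e"
  have r: "coset_rep A D C \<in> D" "list_coset A (coset_rep A D C) = C" if "C \<in> carrier ?N" for C
    using that coset_rep[of _ D A] by (auto simp: carrier_quotient_module)
  have f: "?f ` (carrier ?N \<times> carrier ?M) \<subseteq> carrier (add_monoid K)"
    using r by (auto simp: as_module_def D_carr c)
  obtain h where h: "h \<in> hom (free_Abelian_group (carrier ?N \<times> carrier ?M)) (add_monoid K)"
    and hf: "\<And>p. p \<in> carrier ?N \<times> carrier ?M \<Longrightarrow> h (frag_of p) = ?f p"
    using comm_group.free_Abelian_group_universal[OF a_comm_group f] by blast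
  interpret h: group_hom "free_Abelian_group (carrier ?N \<times> carrier ?M)" "add_monoid K" h
    using h by (simp add: group_hom_def group_hom_axioms_def a_group)
  have h_diff: "h (a - b) = h a \<ominus> h b"
    if "a \<in> carrier (free_Abelian_group (carrier ?N \<times> carrier ?M))"
      "b \<in> carrier (free_Abelian_group (carrier ?N \<times> carrier ?M))" for a b
    using h.hom_mult[OF that(1) h.G.inv_closed[OF that(2)]] h.hom_inv[OF that(2)] that
    by (simp add: a_minus_def a_inv_def)
  have carr_diff: "a - b \<in> carrier (free_Abelian_group (carrier ?N \<times> carrier ?M))"
    if "a \<in> carrier (free_Abelian_group (carrier ?N \<times> carrier ?M))"
      "b \<in> carrier (free_Abelian_group (carrier ?N \<times> carrier ?M))" for a b
    using that keys_diff[of a b] by auto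
  have memJ: "x \<otimes> e \<in> ?J" if "list_coset A x = list_coset A \<zero>" "x \<in> D" "e \<in> E" for x e
    using that list_coset_eq_iff[OF A, of x \<zero>] D_carr by (intro ideal_prod.prod) (auto simp: a_minus_def)
  \<comment> \<open>Negation in \<open>as_module K (carrier K)\<close> and in \<open>K\<close>
    unfolds to the same expression in carrier, zero and addition.\<close>
  have Jsub: "subgroup ?J (add_monoid K)"
    using J submodule.axioms(1)[of ?J ?R "as_module K (carrier K)"]
    by (simp add: is_submodule_def as_module_def subgroup_def a_inv_def m_inv_def)
  have Dminus: "x \<ominus> y \<in> D" if "x \<in> D" "y \<in> D" for x y
    using submodule_minus[OF submodule_D] that .
  interpret N: module ?R ?N by (rule N)
  interpret M: module ?R ?M by (rule M)
  have "h (frag_of (list_coset A \<one>, z)) \<in> ?J"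
  proof (rule tensor_relations_hom[OF N M h a_group Jsub _ _ _ rel])
    fix C C' e assume a: "C \<in> carrier ?N" "C' \<in> carrier ?N" "e \<in> carrier ?M"
    let ?x = "coset_rep A D (C \<oplus>\<^bsub>?N\<^esub> C')" and ?y = "coset_rep A D C" and ?y' = "coset_rep A D C'"
    have D: "?x \<in> D" "?y \<in> D" "?y' \<in> D" using a r by auto
    have e: "e \<in> E" using a by (simp add: as_module_def)
    have "list_coset A ?x = list_coset A (?y \<oplus> ?y')"
      using r(2)[OF N.a_closed[OF a(1,2)]] add_quotient_module[OF A, of ?y ?y' D] D D_carr
      by (simp add: r(2)[OF a(1)] r(2)[OF a(2)])
    then have "?x \<ominus> (?y \<oplus> ?y') \<in> A" using D D_carr by (subst (asm) list_coset_eq_iff[OF A]) auto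
    then have "(?x \<ominus> (?y \<oplus> ?y')) \<otimes> e \<in> ?J"
      using D e submodule_add[OF submodule_D] Dminus by (intro ideal_prod.prod) auto
    moreover have "(?x \<ominus> (?y \<oplus> ?y')) \<otimes> e = ?x \<otimes> e \<ominus> ?y \<otimes> e \<ominus> ?y' \<otimes> e"
      using D[THEN D_carr] c[OF e] by algebra
    ultimately show "h (frag_of (C \<oplus>\<^bsub>?N\<^esub> C', e) - frag_of (C, e) - frag_of (C', e)) \<in> ?J"
      using a by (simp add: h_diff carr_diff hf del: carrier_free_Abelian_group_iff)
  next
    fix C e e' assume a: "C \<in> carrier ?N" "e \<in> carrier ?M" "e' \<in> carrier ?M"
    have e: "e \<in> carrier K" "e' \<in> carrier K" using a c by (auto simp: as_module_def)
    have "coset_rep A D C \<otimes> (e \<oplus> e') \<ominus> coset_rep A D C \<otimes> e \<ominus> coset_rep A D C \<otimes> e' = \<zero>"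
      using e r(1)[OF a(1), THEN D_carr] by algebra
    moreover have "e \<oplus>\<^bsub>?M\<^esub> e' = e \<oplus> e'" by (simp add: as_module_def)
    ultimately show "h (frag_of (C, e \<oplus>\<^bsub>?M\<^esub> e') - frag_of (C, e) - frag_of (C, e')) \<in> ?J"
      using a M.add.m_closed[OF a(2,3)] submodule_zero[OF J]
      by (simp add: h_diff carr_diff hf del: carrier_free_Abelian_group_iff)
  next
    fix s C e assume a: "s \<in> carrier ?R" "C \<in> carrier ?N" "e \<in> carrier ?M"
    let ?x = "coset_rep A D (s \<odot>\<^bsub>?N\<^esub> C)" and ?y = "coset_rep A D C"
    have D: "?x \<in> D" "?y \<in> D" "s \<in> D" using a r by auto
    have e: "e \<in> E" using a by (simp add: as_module_def)
    have "list_coset A ?x = list_coset A (s \<otimes> ?y)"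
      using r(2)[OF N.smult_closed[OF a(1,2)]] smult_quotient_module[OF A, of s ?y D] D D_carr
      by (simp add: r(2)[OF a(2)])
    then have "?x \<ominus> s \<otimes> ?y \<in> A" using D D_carr by (subst (asm) list_coset_eq_iff[OF A]) auto
    then have "(?x \<ominus> s \<otimes> ?y) \<otimes> e \<in> ?J"
      using D e submodule_smult[OF submodule_D] Dminus by (intro ideal_prod.prod) auto
    moreover have "(?x \<ominus> s \<otimes> ?y) \<otimes> e = ?x \<otimes> e \<ominus> ?y \<otimes> (s \<otimes> e)"
      using D[THEN D_carr] c[OF e] by algebra
    moreover have "s \<odot>\<^bsub>?M\<^esub> e = s \<otimes> e" by (simp add: as_module_def)
    ultimately show "h (frag_of (s \<odot>\<^bsub>?N\<^esub> C, e) - frag_of (C, s \<odot>\<^bsub>?M\<^esub> e)) \<in> ?J"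
      using a M.smult_closed[OF a(1,3)]
      by (simp add: h_diff carr_diff hf del: carrier_free_Abelian_group_iff)
  qed
  moreover have one: "\<one> \<in> D" using subringE(3)[OF subring_D] .
  ultimately have J1: "coset_rep A D (list_coset A \<one>) \<otimes> z \<in> ?J"
    using z by (simp add: hf as_module_def carrier_quotient_module)
  \<comment> \<open>The chosen representative of the coset of \<open>\<one>\<close> may differ from
    \<open>\<one>\<close>. The difference lies in \<open>A \<inter> D\<close>, so the value of
    \<open>h\<close> is still \<open>z\<close> modulo \<open>?J\<close>.\<close>
  have x: "coset_rep A D (list_coset A \<one>) \<in> D" "list_coset A (coset_rep A D (list_coset A \<one>)) = list_coset A \<one>" using coset_rep one by auto
  then have "coset_rep A D (list_coset A \<one>) \<ominus> \<one> \<in> A" using D_carr by (subst (asm) list_coset_eq_iff[OF A]) auto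
  then have "(coset_rep A D (list_coset A \<one>) \<ominus> \<one>) \<otimes> z \<in> ?J"
    using x z one Dminus by (intro ideal_prod.prod) auto
  with J1 have "coset_rep A D (list_coset A \<one>) \<otimes> z \<ominus> (coset_rep A D (list_coset A \<one>) \<ominus> \<one>) \<otimes> z \<in> ?J"
    by (rule submodule_minus[OF J])
  moreover have "coset_rep A D (list_coset A \<one>) \<otimes> z \<ominus> (coset_rep A D (list_coset A \<one>) \<ominus> \<one>) \<otimes> z = z"
    using D_carr[OF x(1)] c[OF z] by algebra
  ultimately show ?thesis by simp
qed

text \<open>Since \<open>E\<close> is flat, tensoring the inclusion of \<open>(D + A) / A\<close> into \<open>K / A\<close> with \<open>E\<close> yields the
  injectivity of \<open>E / (A \<inter> D) E \<rightarrow> K / A E\<close>.\<close>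

lemma flat_overring_inter:
  assumes A: "A \<in> fractional_ideals K D" and E: "flat_overring K D E"
    and z: "z \<in> E" "z \<in> A \<cdot> E"
  shows "z \<in> (A \<inter> D) \<cdot> E"
proof -
  let ?R = "K\<lparr>carrier := D\<rparr>" and ?M = "as_module K E"
  let ?P = "quotient_module A (carrier K)" and ?N = "quotient_module A D"
  from A obtain d where sub: "is_submodule K D A" and d: "d \<in> D" "d \<noteq> \<zero>" "\<forall>a\<in>A. d \<otimes> a \<in> D"
    by (auto simp: fractional_ideals_def)
  have E': "overring K D E" "flat_module ?R ?M" using E by (auto simp: flat_overring_def)
  have K: "is_submodule K D (carrier K)" by (auto simp: is_submodule_iff D_carr)
  have N: "module ?R ?N" and P: "module ?R ?P"
    using module_quotient_module[OF sub] K submodule_D by auto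
  have M: "module ?R ?M" using E' by (simp add: flat_module_def)
  \<comment> \<open>The inclusion of \<open>(D + A) / A\<close> into \<open>K / A\<close>; it is
    linear because the operations of \<open>quotient_module\<close> are the same for both.\<close>
  have ids: "id \<in> linear_maps ?R ?N ?P"
    by (auto simp: linear_maps_def hom_def quotient_module_def D_carr)
  have one: "\<one> \<in> D" using subringE(3)[OF subring_D] .
  have i: "inv d \<in> carrier K" "d \<otimes> inv d = \<one>"
    using d D_carr by (auto simp: field_Units)
  let ?T = "tensor_relations ?R ?P ?M"
  interpret T: subgroup ?T "free_Abelian_group (carrier ?P \<times> carrier ?M)"
    by (rule tensor_relations_subgroup[OF P M])
  \<comment> \<open>Writing \<open>\<one>\<close> as \<open>d \<otimes> inv d\<close> moves
    \<open>d\<close> to the right factor. The resulting tensor of \<open>inv d\<close> and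
    \<open>d \<otimes> z\<close> vanishes because \<open>z \<in> A \<cdot> E\<close>.\<close>
  have "frag_of (d \<odot>\<^bsub>?P\<^esub> list_coset A (inv d), z) - frag_of (list_coset A (inv d), d \<odot>\<^bsub>?M\<^esub> z) \<in> ?T"
    using d i z by (intro tensor_relations_smult) (auto simp: carrier_quotient_module as_module_def)
  moreover have "d \<odot>\<^bsub>?P\<^esub> list_coset A (inv d) = list_coset A \<one>"
    using sub d i by (simp add: smult_quotient_module)
  moreover have "d \<odot>\<^bsub>?M\<^esub> z = d \<otimes> z" by (simp add: as_module_def)
  ultimately have "frag_of (list_coset A \<one>, z) - frag_of (list_coset A (inv d), d \<otimes> z) \<in> ?T" by simp
  from T.m_closed[OF this] tensor_relations_submodule_mult[OF sub E'(1) d z(2)]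
  have "frag_of (id (list_coset A \<one>), z) \<in> ?T" by fastforce
  then have "frag_of (list_coset A \<one>, z) \<in> tensor_relations ?R ?N ?M"
    using one z by (intro flat_module_tensor_relations[OF E'(2) N P ids])
      (auto simp: carrier_quotient_module as_module_def)
  then show ?thesis
    by (rule tensor_relations_quotient_module[OF sub E'(1) z(1)])
qed

text \<open>A common denominator \<open>d\<close> of \<open>A\<close> takes a nonzero element of
  \<open>A\<close> to a nonzero element of \<open>A \<inter> D\<close>; inside \<open>D\<close> the
  element \<open>\<one>\<close> is a denominator.\<close>

lemma fractional_ideals_inter_D:
  assumes A: "A \<in> fractional_ideals K D"
  shows "A \<inter> D \<in> fractional_ideals K D"
proof -
  from A obtain d where sub: "is_submodule K D A" and d: "d \<in> D" "d \<noteq> \<zero>" "\<forall>a\<in>A. d \<otimes> a \<in> D"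
    and "A \<noteq> {\<zero>}"
    by (auto simp: fractional_ideals_def)
  with submodule_zero obtain a where a: "a \<in> A" "a \<noteq> \<zero>" by blast
  then have "d \<otimes> a \<in> A \<inter> D" "d \<otimes> a \<noteq> \<zero>"
    using d submodule_smult[OF sub] submodule_carr[OF sub] by (auto simp: integral_iff D_carr)
  then have "A \<inter> D \<noteq> {\<zero>}" by blast
  moreover have "\<one> \<in> D - {\<zero>}" "\<forall>a \<in> A \<inter> D. \<one> \<otimes> a \<in> D"
    using subringE(3)[OF subring_D] D_carr by auto
  ultimately show ?thesis
    using submodule_inter[OF sub submodule_D] unfolding fractional_ideals_def by blast
qed

section \<open>The star operation\<close>

lemma star_of_mono: "A \<subseteq> B \<Longrightarrow> star_of K I E A \<subseteq> star_of K I E B"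
  unfolding star_of_def by (intro Int_mono INT_anti_mono ideal_prod_mono order.refl)

context
  fixes I :: "'i set" and E :: "'i \<Rightarrow> 'a set"
  assumes flat: "\<And>\<alpha>. \<alpha> \<in> I \<Longrightarrow> flat_overring K D (E \<alpha>)"
    and D_eq: "D = carrier K \<inter> (\<Inter>\<alpha>\<in>I. E \<alpha>)"
begin

lemma overring_E: "\<alpha> \<in> I \<Longrightarrow> overring K D (E \<alpha>)"
  using flat by (simp add: flat_overring_def)

lemma submodule_star_of:
  assumes "is_submodule K D A"
  shows "is_submodule K D (star_of K I E A)"
proof -
  have "is_submodule K D (A \<cdot> E \<alpha>)" if "\<alpha> \<in> I" for \<alpha>
    using ideal_prod_submodule(1)[OF assms overring_E[OF that]] .
  then show ?thesis
    unfolding star_of_def is_submodule_iff by (auto simp: D_carr)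
qed

lemma subset_star_of:
  assumes "is_submodule K D A"
  shows "A \<subseteq> star_of K I E A"
  unfolding star_of_def
  by (intro Int_greatest INT_greatest subset_ideal_prod[OF assms overring_E] subsetI submodule_carr[OF assms])

text \<open>Each \<open>E \<alpha>\<close> is a ring containing \<open>A\<close>, so it contains the
  product of \<open>A\<close> with \<open>E \<alpha>\<close>; intersecting over \<open>I\<close>
  gives \<open>D\<close> by \<open>D_eq\<close>.\<close>

lemma star_of_subset_D:
  assumes "A \<subseteq> D"
  shows "star_of K I E A \<subseteq> D"
proof -
  have "z \<in> E \<alpha>" if "\<alpha> \<in> I" "z \<in> A \<cdot> E \<alpha>" for z \<alpha>
  proof -
    have E: "subring (E \<alpha>) K" "A \<subseteq> E \<alpha>"
      using assms overring_E[OF that(1)] by (auto simp: overring_def)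
    from that(2) show ?thesis
    proof induction
      case (prod a e)
      then show ?case by (intro subringE(6)[OF E(1)]) (rule subsetD[OF E(2)])
    next
      case (sum y z)
      then show ?case by (intro subringE(7)[OF E(1)])
    qed
  qed
  then show ?thesis by (subst D_eq) (auto simp: star_of_def)
qed

text \<open>A \<open>D\<close>-submodule containing \<open>\<one>\<close> contains all of
  \<open>D\<close>, so the equality reduces to testing one element.\<close>

lemma star_of_eq_D:
  assumes A: "is_submodule K D A" and "\<one> \<in> star_of K I E A" "star_of K I E A \<subseteq> D"
  shows "star_of K I E A = D"
proof
  show "D \<subseteq> star_of K I E A"
    using submodule_smult[OF submodule_star_of[OF A] _ assms(2)] by (auto simp: D_carr)
qed (rule assms)

section \<open>The two implications\<close>

lemma star_of_fg_eq_D: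
  assumes fc: "finite_character K D (star_of K I E)"
    and A: "A \<in> fractional_ideals K D" "star_of K I E A = D"
  shows "\<exists>B. ideal B (K\<lparr>carrier := D\<rparr>) \<and> B \<in> fg_fractional_ideals K D \<and> B \<subseteq> A \<and>
            star_of K I E B = D"
proof -
  have "\<one> \<in> star_of K I E A" using subringE(3)[OF subring_D] A by simp
  then obtain B where B: "B \<in> fg_fractional_ideals K D" "B \<subseteq> A" "\<one> \<in> star_of K I E B"
    using fc A unfolding finite_character_def by blast
  then have sub: "is_submodule K D B" by (simp add: fg_fractional_ideals_def fractional_ideals_def)
  \<comment> \<open>Monotonicity bounds the star of \<open>B\<close> by that of \<open>A\<close>,
    which is \<open>D\<close>, and \<open>\<one>\<close> gives the other inclusion. Then
    \<open>B\<close> lies in its own star, hence in \<open>D\<close>, and is an ideal.\<close>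
  have star: "star_of K I E B = D"
    using star_of_eq_D[OF sub B(3)] star_of_mono[OF B(2), of I E] A(2) by simp
  then have BD: "B \<subseteq> D" using subset_star_of[OF sub] by simp
  have "ideal B (K\<lparr>carrier := D\<rparr>)" using sub BD by (rule submodule_imp_ideal)
  with B star show ?thesis by blast
qed

text \<open>The substantial inclusion of finite character. Dividing by \<open>x\<close> reduces it
  to membership of \<open>\<one>\<close>, which the hypothesis on ideals with star \<open>D\<close>
  can handle.\<close>

lemma star_of_mem_fg:
  assumes fg: "\<And>A. A \<in> fractional_ideals K D \<Longrightarrow> star_of K I E A = D \<Longrightarrow>
      \<exists>B. B \<in> fg_fractional_ideals K D \<and> B \<subseteq> A \<and> star_of K I E B = D"
    and A: "A \<in> fractional_ideals K D" and x: "x \<in> star_of K I E A"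
  shows "\<exists>B. B \<in> fg_fractional_ideals K D \<and> B \<subseteq> A \<and> x \<in> star_of K I E B"
proof (cases "x = \<zero>")
  case True
  from A obtain d where sub: "is_submodule K D A" and d: "d \<in> D - {\<zero>}" "\<forall>a\<in>A. d \<otimes> a \<in> D"
    and "A \<noteq> {\<zero>}"
    unfolding fractional_ideals_def by blast
  with submodule_zero obtain a where a: "a \<in> A" "a \<noteq> \<zero>" by blast
  \<comment> \<open>Division by \<open>x\<close> is impossible here. Every star contains
    \<open>\<zero>\<close>, but the zero module is excluded from the fractional ideals, so a nonzero
    \<open>a \<in> A\<close> generates the witness.\<close>
  let ?B = "is_submodule K D hull {a}"
  have aK: "{a} \<subseteq> carrier K" using a submodule_carr[OF sub] by auto
  have B: "is_submodule K D ?B" "?B \<subseteq> A" "a \<in> ?B"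
    using submodule_hull[OF aK] a sub by (simp_all add: hull_minimal hull_inc)
  then have "?B \<noteq> {\<zero>}" "\<forall>b\<in>?B. d \<otimes> b \<in> D" using a d by auto
  with B(1) d have "?B \<in> fractional_ideals K D"
    unfolding fractional_ideals_def by blast
  then have "?B \<in> fg_fractional_ideals K D"
    using aK unfolding fg_fractional_ideals_def by (blast intro: exI[of _ "{a}"])
  moreover have "x \<in> star_of K I E ?B"
    using True submodule_zero[OF submodule_star_of[OF B(1)]] by simp
  ultimately show ?thesis using B(2) by blast
next
  case False
  have xK: "x \<in> carrier K" using x by (simp add: star_of_def)
  note ix = inv_nonzero[OF xK False]
  have sub: "is_submodule K D A" using A by (simp add: fractional_ideals_def)
  define A' where "A' = (\<otimes>) (inv x) ` A"
  have A': "A' \<in> fractional_ideals K D"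
    unfolding A'_def using A ix by (intro fractional_ideals_scale)
  then have AD: "A' \<inter> D \<in> fractional_ideals K D" by (rule fractional_ideals_inter_D)
  then have AD_sub: "is_submodule K D (A' \<inter> D)" by (simp add: fractional_ideals_def)
  \<comment> \<open>Flatness enters here: \<open>\<one>\<close> lies in \<open>E \<alpha>\<close>
    and, after scaling \<open>x \<in> A \<cdot> E \<alpha>\<close> by \<open>inv x\<close>, also in
    \<open>A' \<cdot> E \<alpha>\<close>.\<close>
  have "\<one> \<in> (A' \<inter> D) \<cdot> E \<alpha>" if \<alpha>: "\<alpha> \<in> I" for \<alpha>
  proof (rule flat_overring_inter[OF A' flat[OF \<alpha>]])
    show "\<one> \<in> E \<alpha>" using overring_E[OF \<alpha>] subringE(3) by (auto simp: overring_def)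
    have "x \<in> A \<cdot> E \<alpha>" using x \<alpha> by (simp add: star_of_def)
    from ideal_prod_scale[OF sub overring_E[OF \<alpha>] ix(1) this]
    show "\<one> \<in> A' \<cdot> E \<alpha>" using xK False by (simp add: A'_def field_Units)
  qed
  then have "\<one> \<in> star_of K I E (A' \<inter> D)" by (simp add: star_of_def)
  then have "star_of K I E (A' \<inter> D) = D"
    by (intro star_of_eq_D AD_sub star_of_subset_D) auto
  from fg[OF AD this] obtain B where B: "B \<in> fg_fractional_ideals K D" "B \<subseteq> A' \<inter> D"
    "star_of K I E B = D" by blast
  have B_sub: "is_submodule K D B"
    using B(1) by (simp add: fg_fractional_ideals_def fractional_ideals_def)
  have "(\<otimes>) x ` B \<in> fg_fractional_ideals K D"
    using B(1) xK False by (rule fg_fractional_ideals_scale)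
  moreover have "(\<otimes>) x ` B \<subseteq> A"
  proof -
    have "(\<otimes>) x ` B \<subseteq> (\<otimes>) x ` A'" using B(2) by blast
    also have "\<dots> = A"
      unfolding A'_def using xK False submodule_carr[OF sub] by (intro scale_scale_inv) auto
    finally show ?thesis .
  qed
  \<comment> \<open>Scaling back: \<open>\<one>\<close> lies in every product of \<open>B\<close>
    with \<open>E \<alpha>\<close>, so \<open>x\<close> lies in every product of the scaled
    \<open>B\<close> with \<open>E \<alpha>\<close>.\<close>
  moreover have "x \<in> star_of K I E ((\<otimes>) x ` B)"
  proof -
    have "\<one> \<in> star_of K I E B" using B(3) subringE(3)[OF subring_D] by simp
    then have "x \<otimes> \<one> \<in> ((\<otimes>) x ` B) \<cdot> E \<alpha>" if "\<alpha> \<in> I" for \<alpha>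
      using that ideal_prod_scale[OF B_sub overring_E[OF that] xK, of \<one>] by (auto simp: star_of_def)
    then show ?thesis using xK by (simp add: star_of_def)
  qed
  ultimately show ?thesis by blast
qed

lemma finite_character_iff:
  "finite_character K D (star_of K I E) \<longleftrightarrow>
    (\<forall>A \<in> fractional_ideals K D. star_of K I E A = D \<longrightarrow>
       (\<exists>B. ideal B (K\<lparr>carrier := D\<rparr>) \<and> B \<in> fg_fractional_ideals K D \<and> B \<subseteq> A \<and>
            star_of K I E B = D))"
    (is "?fc \<longleftrightarrow> ?fg")
proof
  assume ?fc
  then show ?fg by (intro ballI impI star_of_fg_eq_D)
next
  assume ?fg
  then have fg: "\<exists>B. B \<in> fg_fractional_ideals K D \<and> B \<subseteq> A \<and> star_of K I E B = D"
    if "A \<in> fractional_ideals K D" "star_of K I E A = D" for A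
    using that by blast
  show ?fc
    unfolding finite_character_def
  proof (intro ballI equalityI subsetI)
    fix A x assume "A \<in> fractional_ideals K D" "x \<in> star_of K I E A"
    from star_of_mem_fg[OF fg this]
    show "x \<in> \<Union>{star_of K I E B | B. B \<in> fg_fractional_ideals K D \<and> B \<subseteq> A}" by blast
  next
    fix A x assume "x \<in> \<Union>{star_of K I E B | B. B \<in> fg_fractional_ideals K D \<and> B \<subseteq> A}"
    then obtain B where "B \<subseteq> A" "x \<in> star_of K I E B" by blast
    then show "x \<in> star_of K I E A" using star_of_mono[of B A I E] by blast
  qed
qed

end
end

theorem theorem3p6:
  fixes K :: "('a, 'e) ring_scheme" and D :: "'a set"
    and I :: "'i set" and E :: "'i \<Rightarrow> 'a set"
  assumes "quotient_field K D"
    and "\<forall>\<alpha>\<in>I. flat_overring K D (E \<alpha>)"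
    and "D = carrier K \<inter> (\<Inter>\<alpha>\<in>I. E \<alpha>)"
  shows "finite_character K D (star_of K I E) \<longleftrightarrow>
    (\<forall>A \<in> fractional_ideals K D. star_of K I E A = D \<longrightarrow>
       (\<exists>B. ideal B (K\<lparr>carrier := D\<rparr>) \<and> B \<in> fg_fractional_ideals K D \<and> B \<subseteq> A \<and>
            star_of K I E B = D))"
proof -
  interpret quotient_field_pair K D
    using assms(1)
    by (intro quotient_field_pair.intro quotient_field_pair_axioms.intro) (simp_all add: quotient_field_def)
  show ?thesis
    using assms(2,3) by (intro finite_character_iff) auto
qed

end
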